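(* Let $Y$ be a random variable whose moment generating function $E[e^{tY}]$ exists for $|t|<r$, for some $r>0$. Define $T^{Y}(n,k)$ for $n\ge k\ge0$ by $$\frac{1}{k!}\Big(E\big[e^{\frac{Y}{2}t}\big]-E\big[e^{-\frac{Y}{2}t}\big]\Big)^{k}=\sum_{n=k}^{\infty}T^{Y}(n,k)\frac{t^{n}}{n!},$$ and define the polynomials $F_n^{(c,Y)}(x)$ by $$\sum_{n=0}^{\infty}F_{n}^{(c,Y)}(x)\frac{t^{n}}{n!}=\frac{1}{1-x(E[e^{\frac{Y}{2}t}]-E[e^{-\frac{Y}{2}t}])}.$$ Then for every $n\ge0$, $$F_{n}^{(c,Y)}(x)= \sum_{k=0}^{n}k!\,T^{Y}(n,k)x^{k}.$$
   Context: $F_n^{(c,Y)}(x)$ are called the probabilistic central Fubini polynomials associated with $Y$; identities are of power series in $t$. *)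

theory Defs
  imports "HOL-Probability.Probability"
begin

text \<open>
  Identities between functions of \<open>t\<close> and power series in \<open>t\<close> are read as expansions at \<open>0\<close>
  (constant \<open>has_fps_expansion\<close>): the series has positive radius of convergence and equals the
  function in a neighbourhood of \<open>0\<close>. The expansion of a function is unique when it exists, so
  the generating functions below determine their coefficients.
\<close>

definition mgf_diff :: "'a measure \<Rightarrow> ('a \<Rightarrow> real) \<Rightarrow> real \<Rightarrow> real" where
  "mgf_diff M Y t =
     prob_space.expectation M (\<lambda>\<omega>. exp (Y \<omega> / 2 * t)) -
     prob_space.expectation M (\<lambda>\<omega>. exp (- (Y \<omega> / 2) * t))"

text \<open>
  \<open>T\<^sup>Y(n,k)\<close> is \<open>n!\<close> times the \<open>n\<close>-th coefficient, for all \<open>n\<close>. The series in the definition may be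
  started at \<open>n = k\<close> because the coefficients below \<open>k\<close> vanish: \<open>mgf_diff M Y 0 = 0\<close>.
\<close>

definition prob_central_stirling :: "'a measure \<Rightarrow> ('a \<Rightarrow> real) \<Rightarrow> nat \<Rightarrow> nat \<Rightarrow> real" where
  "prob_central_stirling M Y n k =
     fact n * fps_nth (THE F. (\<lambda>t. 1 / fact k * mgf_diff M Y t ^ k) has_fps_expansion F) n"

text \<open>
  The sequence of polynomials in \<open>x\<close> with the given exponential generating function. The
  neighbourhood of \<open>t = 0\<close> in which the expansion holds may depend on \<open>x\<close>.
\<close>

definition prob_central_fubini_poly :: "'a measure \<Rightarrow> ('a \<Rightarrow> real) \<Rightarrow> nat \<Rightarrow> real poly" where
  "prob_central_fubini_poly M Y =
     (THE F. \<forall>x. (\<lambda>t. 1 / (1 - x * mgf_diff M Y t)) has_fps_expansion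
                  Abs_fps (\<lambda>n. poly (F n) x / fact n))"

end

theory Submission
  imports Defs
begin

text \<open>
  Dominating the exponential series by \<open>exp (t Y) + exp (- t Y)\<close> expands the moment generating
  function at \<open>0\<close>. Hence \<open>mgf_diff M Y\<close> has an expansion \<open>D\<close> with zero constant term, and
  \<open>k! T(n,k) = n! [t\<^sup>n] D\<^sup>k\<close>. The generating function of the Fubini polynomials expands as the
  geometric series in \<open>x\<close> composed with \<open>D\<close>, whose \<open>n\<close>-th coefficient is
  \<open>\<Sum>k\<le>n. x\<^sup>k [t\<^sup>n] D\<^sup>k\<close>.
\<close>

text \<open>Dividing the zero function by \<open>z ^ subdegree F\<close> and filling in the leading
  coefficient \<open>c\<close> at 0 gives a function that must be continuous at 0. Off 0 it
  vanishes, so \<open>c = 0\<close>, which no nonzero series allows.\<close>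

lemma has_fps_expansion_0_unique:
  fixes F :: "'a :: {banach, real_normed_field} fps"
  assumes "(\<lambda>_. 0) has_fps_expansion F"
  shows "F = 0"
proof (rule ccontr)
  assume "F \<noteq> 0"
  define c where "c = fps_nth F (subdegree F)"
  have "(\<lambda>z. if z = 0 then c else 0 / z ^ subdegree F) has_fps_expansion fps_shift (subdegree F) F"
    by (rule has_fps_expansion_shift) (use assms in \<open>auto simp: c_def\<close>)
  hence "isCont (\<lambda>z. if z = 0 then c else 0 / z ^ subdegree F) 0"
    by (rule has_fps_expansion_imp_continuous)
  hence "(\<lambda>z. if z = 0 then c else 0 / z ^ subdegree F) \<midarrow>0\<rightarrow> c"
    by (simp add: isCont_def)
  moreover have "(\<lambda>z. if z = 0 then c else 0 / z ^ subdegree F) \<midarrow>0\<rightarrow> 0"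
    by (rule tendsto_eventually) (auto simp: eventually_at_filter)
  ultimately have "c = 0"
    by (rule LIM_unique)
  with \<open>F \<noteq> 0\<close> show False
    by (simp add: c_def)
qed

text \<open>The library states this for complex functions only.\<close>

lemma has_fps_expansion_unique:
  fixes F G :: "'a :: {banach, real_normed_field} fps"
  assumes "f has_fps_expansion F" and "f has_fps_expansion G"
  shows "F = G"
  using has_fps_expansion_0_unique[of "F - G"] has_fps_expansion_diff[OF assms] by simp

lemma the_fps_expansion:
  fixes F :: "'a :: {banach, real_normed_field} fps"
  assumes "f has_fps_expansion F"
  shows "(THE F. f has_fps_expansion F) = F"
  using assms has_fps_expansion_unique by blast

text \<open>This is the geometric series \<open>A\<close> in \<open>x\<close> with \<open>D\<close>
  substituted for the variable. The inner sum stops at \<open>n\<close> because \<open>D ^ k\<close>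
  has no terms below degree \<open>k\<close>.\<close>

lemma fps_inverse_one_minus_const_mult:
  fixes D :: "'a :: field fps"
  assumes "fps_nth D 0 = 0"
  shows "inverse (1 - fps_const x * D) = Abs_fps (\<lambda>n. \<Sum>k=0..n. x ^ k * fps_nth (D ^ k) n)"
proof -
  define A where "A = Abs_fps (\<lambda>k. x ^ k)"
  have "(1 - fps_const x * fps_X) * A = 1"
  proof (rule fps_ext)
    fix n
    have "(1 - fps_const x * fps_X) * A = A - fps_const x * (fps_X * A)"
      by (simp add: algebra_simps)
    thus "fps_nth ((1 - fps_const x * fps_X) * A) n = fps_nth 1 n"
      by (cases n) (simp_all add: A_def)
  qed
  hence "((1 - fps_const x * fps_X) * A) oo D = 1"
    by simp
  \<comment> \<open>Composition with \<open>D\<close> respects products because \<open>D\<close> has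
    zero constant term.\<close>
  hence "(1 - fps_const x * D) * (A oo D) = 1"
    by (simp add: fps_compose_mult_distrib[OF assms] fps_compose_sub_distrib
          fps_X_fps_compose_startby0[OF assms])
  hence "inverse (1 - fps_const x * D) = A oo D"
    by (rule fps_inverse_unique)
  also have "\<dots> = Abs_fps (\<lambda>n. \<Sum>k=0..n. x ^ k * fps_nth (D ^ k) n)"
    by (simp add: fps_eq_iff fps_compose_nth A_def)
  finally show ?thesis .
qed

text \<open>The exponential series is integrated term by term. Integrability at both
  \<open>t\<close> and \<open>- t\<close> is what makes the dominating function integrable.\<close>

lemma sums_expectation_exp:
  fixes Y :: "'a \<Rightarrow> real"
  assumes [measurable]: "Y \<in> borel_measurable M"
    and "integrable M (\<lambda>\<omega>. exp (t * Y \<omega>))" and "integrable M (\<lambda>\<omega>. exp (- t * Y \<omega>))"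
  shows "(\<lambda>n. (\<integral>\<omega>. Y \<omega> ^ n \<partial>M) / fact n * t ^ n) sums (\<integral>\<omega>. exp (t * Y \<omega>) \<partial>M)"
proof -
  define f where "f = (\<lambda>n \<omega>. (t * Y \<omega>) ^ n / fact n)"
  have [measurable]: "f n \<in> borel_measurable M" for n
    unfolding f_def by measurable
  have f_sums: "(\<lambda>n. f n \<omega>) sums exp (t * Y \<omega>)" for \<omega>
    using exp_converges[of "t * Y \<omega>"] by (simp add: f_def field_simps)
  have norm_f_sums: "(\<lambda>n. norm (f n \<omega>)) sums exp \<bar>t * Y \<omega>\<bar>" for \<omega>
    using exp_converges[of "\<bar>t * Y \<omega>\<bar>"]
    by (simp add: f_def divide_inverse power_abs abs_mult power_mult_distrib mult_ac)
  have partial: "(\<Sum>i<n. norm (f i \<omega>)) \<le> exp (t * Y \<omega>) + exp (- t * Y \<omega>)" for n \<omega>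
  proof -
    have "(\<Sum>i<n. norm (f i \<omega>)) \<le> exp \<bar>t * Y \<omega>\<bar>"
      using sum_le_suminf[OF sums_summable[OF norm_f_sums], of "{..<n}"] sums_unique[OF norm_f_sums]
      by simp
    also have "\<dots> \<le> exp (t * Y \<omega>) + exp (- t * Y \<omega>)"
      by (simp add: abs_if)
    finally show ?thesis .
  qed
  have bound_integrable: "integrable M (\<lambda>\<omega>. exp (t * Y \<omega>) + exp (- t * Y \<omega>))"
    using assms by simp
  have f_integrable: "integrable M (f n)" for n
  proof (rule Bochner_Integration.integrable_bound[OF bound_integrable])
    \<comment> \<open>A single term is at most the partial sum that ends with it, since the earlier
      terms are nonnegative.\<close>
    have "norm (f n \<omega>) \<le> exp (t * Y \<omega>) + exp (- t * Y \<omega>)" for \<omega>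
      using partial[where n = "Suc n" and \<omega> = \<omega>] sum_abs_ge_zero[of "\<lambda>i. f i \<omega>" "{..<n}"]
      unfolding real_norm_def sum.lessThan_Suc by linarith
    thus "AE \<omega> in M. norm (f n \<omega>) \<le> norm (exp (t * Y \<omega>) + exp (- t * Y \<omega>))"
      by (intro AE_I2) (simp add: order_trans[OF _ abs_ge_self])
  qed simp
  \<comment> \<open>Absolute summability of the integrals licenses the interchange of sum and
    integral; the integral of the dominating function bounds all partial sums.\<close>
  have "summable (\<lambda>n. \<integral>\<omega>. norm (f n \<omega>) \<partial>M)"
  proof (rule summableI_nonneg_bounded)
    fix n
    have "(\<Sum>i<n. \<integral>\<omega>. norm (f i \<omega>) \<partial>M) = (\<integral>\<omega>. (\<Sum>i<n. norm (f i \<omega>)) \<partial>M)"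
      using f_integrable by (intro Bochner_Integration.integral_sum[symmetric]) auto
    also have "\<dots> \<le> (\<integral>\<omega>. exp (t * Y \<omega>) + exp (- t * Y \<omega>) \<partial>M)"
      using f_integrable by (intro integral_mono bound_integrable partial) auto
    finally show "(\<Sum>i<n. \<integral>\<omega>. norm (f i \<omega>) \<partial>M) \<le> (\<integral>\<omega>. exp (t * Y \<omega>) + exp (- t * Y \<omega>) \<partial>M)" .
  qed simp
  hence "(\<lambda>n. integral\<^sup>L M (f n)) sums (\<integral>\<omega>. (\<Sum>n. f n \<omega>) \<partial>M)"
    using sums_summable[OF norm_f_sums] by (intro sums_integral f_integrable AE_I2) auto
  moreover have "(\<Sum>n. f n \<omega>) = exp (t * Y \<omega>)" for \<omega>
    using f_sums by (rule sums_unique[symmetric])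
  moreover have "integral\<^sup>L M (f n) = (\<integral>\<omega>. Y \<omega> ^ n \<partial>M) / fact n * t ^ n" for n
    by (simp add: f_def power_mult_distrib)
  ultimately show ?thesis
    by simp
qed

lemma has_fps_expansion_expectation_exp:
  fixes Y :: "'a \<Rightarrow> real"
  assumes "Y \<in> borel_measurable M" and "r > 0"
    and "\<And>t. \<bar>t\<bar> < r \<Longrightarrow> integrable M (\<lambda>\<omega>. exp (t * Y \<omega>))"
  shows "(\<lambda>t. \<integral>\<omega>. exp (t * Y \<omega>) \<partial>M) has_fps_expansion
           Abs_fps (\<lambda>n. (\<integral>\<omega>. Y \<omega> ^ n \<partial>M) / fact n)"
proof (rule has_fps_expansionI)
  have "eventually (\<lambda>t::real. t \<in> ball 0 r) (nhds 0)"
    using \<open>r > 0\<close> by (intro eventually_nhds_in_open) auto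
  thus "eventually (\<lambda>t. (\<lambda>n. fps_nth (Abs_fps (\<lambda>n. (\<integral>\<omega>. Y \<omega> ^ n \<partial>M) / fact n)) n * t ^ n)
          sums (\<integral>\<omega>. exp (t * Y \<omega>) \<partial>M)) (nhds 0)"
  proof eventually_elim
    case (elim t)
    hence "integrable M (\<lambda>\<omega>. exp (t * Y \<omega>))" "integrable M (\<lambda>\<omega>. exp (- t * Y \<omega>))"
      using assms(3)[of t] assms(3)[of "- t"] by simp_all
    thus ?case
      using sums_expectation_exp[OF assms(1)] by simp
  qed
qed

lemma mgf_diff_has_fps_expansion:
  assumes "Y \<in> borel_measurable M" and "r > 0"
    and mgf: "\<And>t. \<bar>t\<bar> < r \<Longrightarrow> integrable M (\<lambda>\<omega>. exp (t * Y \<omega>))"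
  obtains D where "mgf_diff M Y has_fps_expansion D" and "fps_nth D 0 = 0"
proof -
  \<comment> \<open>\<open>G c\<close> is the moment series of \<open>c * Y\<close>; the two
    expectations in \<open>mgf_diff\<close> are the cases \<open>c = 1/2\<close> and
    \<open>c = -1/2\<close>.\<close>
  define G where "G = (\<lambda>c. Abs_fps (\<lambda>n. (\<integral>\<omega>. (c * Y \<omega>) ^ n \<partial>M) / fact n))"
  have G: "(\<lambda>t. \<integral>\<omega>. exp (t * (c * Y \<omega>)) \<partial>M) has_fps_expansion G c" if "\<bar>c\<bar> = 1 / 2" for c
    unfolding G_def
  proof (rule has_fps_expansion_expectation_exp)
    show "integrable M (\<lambda>\<omega>. exp (t * (c * Y \<omega>)))" if "\<bar>t\<bar> < r" for t
      using mgf[of "t * c"] that \<open>\<bar>c\<bar> = 1 / 2\<close> by (simp add: abs_mult mult.assoc)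
  qed (use assms in auto)
  have "mgf_diff M Y = (\<lambda>t. (\<integral>\<omega>. exp (t * (1/2 * Y \<omega>)) \<partial>M) - (\<integral>\<omega>. exp (t * (-1/2 * Y \<omega>)) \<partial>M))"
    by (intro ext arg_cong2[where f = "(-)"] Bochner_Integration.integral_cong)
       (simp_all add: mgf_diff_def mult.commute)
  hence "mgf_diff M Y has_fps_expansion G (1/2) - G (-1/2)"
    using has_fps_expansion_diff[OF G[of "1/2"] G[of "-1/2"]] by simp
  \<comment> \<open>Both constant terms are the integral of 1, whatever \<open>c\<close> is, so they
    cancel.\<close>
  moreover have "fps_nth (G (1/2) - G (-1/2)) 0 = 0"
    by (simp add: G_def)
  ultimately show thesis
    by (rule that)
qed

lemma prob_central_stirling_eq:
  assumes "mgf_diff M Y has_fps_expansion D"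
  shows "fact k * prob_central_stirling M Y n k = fact n * fps_nth (D ^ k) n"
proof -
  have "(\<lambda>t. 1 / fact k * mgf_diff M Y t ^ k) has_fps_expansion fps_const (1 / fact k) * D ^ k"
    \<comment> \<open>The power is expanded as a product of \<open>k\<close> equal factors.\<close>
    using has_fps_expansion_prod[of "{..<k}" "\<lambda>_. mgf_diff M Y" "\<lambda>_. D"] assms
    by (intro has_fps_expansion_cmult_left) simp
  thus ?thesis
    by (simp add: prob_central_stirling_def the_fps_expansion)
qed

lemma poly_prob_central_fubini_poly:
  assumes D: "mgf_diff M Y has_fps_expansion D" and D0: "fps_nth D 0 = 0"
  shows "poly (prob_central_fubini_poly M Y n) x = fact n * (\<Sum>k=0..n. x ^ k * fps_nth (D ^ k) n)"
proof -
  \<comment> \<open>The candidate collects the coefficient of each \<open>x ^ k\<close> in the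
    geometric expansion, so that one polynomial serves all \<open>x\<close>.\<close>
  define P where "P = (\<lambda>n. \<Sum>k=0..n. monom (fact n * fps_nth (D ^ k) n) k)"
  have poly_P: "poly (P n) x = fact n * (\<Sum>k=0..n. x ^ k * fps_nth (D ^ k) n)" for n x
    by (simp add: P_def poly_sum poly_monom sum_distrib_left mult_ac)
  have P: "(\<lambda>t. 1 / (1 - x * mgf_diff M Y t)) has_fps_expansion Abs_fps (\<lambda>n. poly (P n) x / fact n)"
    for x
  proof -
    \<comment> \<open>The denominator series has constant term 1, hence is invertible.\<close>
    have "(\<lambda>t. inverse (1 - x * mgf_diff M Y t)) has_fps_expansion inverse (1 - fps_const x * D)"
      using D D0 by (intro fps_expansion_intros) simp_all
    thus ?thesis
      by (simp add: fps_inverse_one_minus_const_mult[OF D0] poly_P inverse_eq_divide)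
  qed
  have "prob_central_fubini_poly M Y = P"
    unfolding prob_central_fubini_poly_def
  proof (rule the_equality)
    show "\<forall>x. (\<lambda>t. 1 / (1 - x * mgf_diff M Y t)) has_fps_expansion
                Abs_fps (\<lambda>n. poly (P n) x / fact n)"
      using P by blast
  next
    fix Q
    assume Q: "\<forall>x. (\<lambda>t. 1 / (1 - x * mgf_diff M Y t)) has_fps_expansion
                     Abs_fps (\<lambda>n. poly (Q n) x / fact n)"
    \<comment> \<open>Uniqueness of expansions applies at each fixed \<open>x\<close>; real
      polynomials that agree at every point are equal.\<close>
    have "poly (Q n) x = poly (P n) x" for n x
      using has_fps_expansion_unique[OF Q[rule_format] P, of x] by (simp add: fps_eq_iff)
    thus "Q = P"
      by (simp add: fun_eq_iff flip: poly_eq_poly_eq_iff)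
  qed
  thus ?thesis
    by (simp add: poly_P)
qed

theorem theorem2p5:
  fixes M :: "'a measure" and Y :: "'a \<Rightarrow> real" and r :: real and n :: nat and x :: real
  assumes "prob_space M"
    and "Y \<in> borel_measurable M"
    and "r > 0"
    and "\<And>t. \<bar>t\<bar> < r \<Longrightarrow> integrable M (\<lambda>\<omega>. exp (t * Y \<omega>))"
  shows "poly (prob_central_fubini_poly M Y n) x =
           (\<Sum>k=0..n. fact k * prob_central_stirling M Y n k * x ^ k)"
proof -
  obtain D where D: "mgf_diff M Y has_fps_expansion D" "fps_nth D 0 = 0"
    using mgf_diff_has_fps_expansion assms(2-4) by blast
  thus ?thesis
    by (simp add: poly_prob_central_fubini_poly prob_central_stirling_eq sum_distrib_left mult_ac)
qed

end
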